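(* $\mathcal{S}_{3s}(2,4)=\mathbb{N}\setminus\{1,2,3,4,5,6,7\}$.
   Context: Let $V$ be a set of $v$ elements and let $k,t$ be positive integers with $t<k<v$. A block is a $k$-subset of $V$. A $\mu$-way $(v,k,t)$ trade of volume $m$ is a family $T=\{T_1,\dots,T_\mu\}$ of $\mu$ pairwise disjoint collections of blocks, each $T_i$ consisting of exactly $m$ blocks, such that for every $t$-subset $S$ of $V$, the number of blocks of $T_i$ containing $S$ is the same for all $i$. It is a Steiner trade if every $t$-subset of $V$ is contained in at most one block of each $T_i$. $\mathcal{S}_{\mu s}(t,k)$ denotes the set of all positive integers $m$ such that a $\mu$-way $(v,k,t)$ Steiner trade of volume $m$ exists for some $v$. Here $\mathbb{N}=\{1,2,3,\dots\}$. *)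

theory Defs
  imports "HOL-Library.Ramsey" "HOL-Library.Disjoint_Sets"
begin

text \<open>
  The \<open>\<mu>\<close> collections are indexed by \<open>{1..\<mu>}\<close>; values of \<open>T\<close> outside this range are irrelevant.
  The blocks, i.e. the \<open>k\<close>-subsets of \<open>V\<close>, form the set \<open>nsets V k\<close>. Collections have no repeated
  blocks; in a Steiner trade, repetition would be impossible anyway, as \<open>t < k\<close>.
\<close>

definition mu_way_trade ::
  "nat \<Rightarrow> 'a set \<Rightarrow> nat \<Rightarrow> nat \<Rightarrow> nat \<Rightarrow> nat \<Rightarrow> (nat \<Rightarrow> 'a set set) \<Rightarrow> bool" where
  "mu_way_trade \<mu> V v k t m T \<longleftrightarrow>
     finite V \<and> card V = v \<and> 0 < t \<and> t < k \<and> k < v \<and>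
     (\<forall>i\<in>{1..\<mu>}. T i \<subseteq> nsets V k \<and> card (T i) = m) \<and>
     disjoint_family_on T {1..\<mu>} \<and>
     (\<forall>S\<in>nsets V t. \<forall>i\<in>{1..\<mu>}. \<forall>j\<in>{1..\<mu>}.
        card {B \<in> T i. S \<subseteq> B} = card {B \<in> T j. S \<subseteq> B})"

definition mu_way_steiner_trade ::
  "nat \<Rightarrow> 'a set \<Rightarrow> nat \<Rightarrow> nat \<Rightarrow> nat \<Rightarrow> nat \<Rightarrow> (nat \<Rightarrow> 'a set set) \<Rightarrow> bool" where
  "mu_way_steiner_trade \<mu> V v k t m T \<longleftrightarrow>
     mu_way_trade \<mu> V v k t m T \<and>
     (\<forall>S\<in>nsets V t. \<forall>i\<in>{1..\<mu>}. card {B \<in> T i. S \<subseteq> B} \<le> 1)"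

text \<open>
  Trades are invariant under relabelling the points, so point sets \<open>V \<subseteq> \<nat>\<close> cover every finite \<open>V\<close>.
\<close>

definition steiner_volumes :: "nat \<Rightarrow> nat \<Rightarrow> nat \<Rightarrow> nat set" where
  "steiner_volumes \<mu> t k =
     {m. 0 < m \<and> (\<exists>v (V :: nat set) T. mu_way_steiner_trade \<mu> V v k t m T)}"

end

theory Submission
  imports Defs
begin

text \<open>
  For the lower bound, compare \<open>F = T 1\<close> with \<open>G = T 2\<close> and \<open>H = T 3\<close>. Every point of the trade lies on at
  least two blocks of \<open>F\<close>. If all four points of a block lie on at least three blocks, then already
  the blocks meeting that block number at least \<open>1 + 4 \<cdot> 2 = 9\<close>. If some point \<open>x\<close> lies on only two blocks
  \<open>B\<close> and \<open>B'\<close> of \<open>F\<close>, then the blocks of \<open>G\<close> through \<open>x\<close>, and likewise those of \<open>H\<close>, arise by exchanging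
  a point of \<open>B\<close> with a point of \<open>B'\<close>. The two exchanges differ, so together they join at least six
  pairs in \<open>(B - {x}) \<times> (B' - {x})\<close>; in \<open>F\<close> these pairs lie on distinct blocks that avoid \<open>x\<close>, which
  gives at least \<open>2 + 6 = 8\<close> blocks.

  Volumes add up under disjoint unions of trades, so trades of volumes 8 to 15 yield all larger
  volumes. They were found by a SAT solver.
\<close>

subsection \<open>Packings and shadows\<close>

definition packing :: "nat \<Rightarrow> 'a set set \<Rightarrow> bool" where
  "packing t F \<longleftrightarrow> (\<forall>B\<in>F. \<forall>C\<in>F. B \<noteq> C \<longrightarrow> card (B \<inter> C) < t)"

text \<open>The standard shadow of a set family. With \<open>packing\<close> it replaces the block
  counts of a Steiner trade by equations between sets.\<close>

definition shadow :: "nat \<Rightarrow> 'a set set \<Rightarrow> 'a set set" where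
  "shadow t F = (\<Union>B\<in>F. nsets B t)"

lemma shadow_Un: "shadow t (F \<union> G) = shadow t F \<union> shadow t G"
  by (simp add: shadow_def)

lemma shadow_subset: "F \<subseteq> Pow V \<Longrightarrow> shadow t F \<subseteq> nsets V t"
  by (auto simp: shadow_def nsets_def)

section \<open>Shadows and packings under injections\<close>

lemma nsets_image:
  assumes "inj_on f A"
  shows "nsets (f ` A) t = image f ` nsets A t"
proof (intro equalityI subsetI)
  fix S assume "S \<in> nsets (f ` A) t"
  then have S: "S \<subseteq> f ` A" "finite S" "card S = t"
    by (auto simp: nsets_def)
  then obtain R where R: "R \<subseteq> A" "S = f ` R"
    by (auto simp: subset_image_iff)
  with assms have inj: "inj_on f R"
    by (blast intro: inj_on_subset)
  with S R have "R \<in> nsets A t"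
    by (auto simp: nsets_def card_image finite_image_iff)
  with R show "S \<in> image f ` nsets A t"
    by blast
next
  fix S assume "S \<in> image f ` nsets A t"
  with assms show "S \<in> nsets (f ` A) t"
    by (auto simp: nsets_def card_image inj_on_subset intro: imageI)
qed

lemma shadow_image:
  assumes "inj_on f V" "F \<subseteq> Pow V"
  shows "shadow t (image f ` F) = image f ` shadow t F"
proof -
  have "nsets (f ` B) t = image f ` nsets B t" if "B \<in> F" for B
    using that assms by (intro nsets_image) (auto intro: inj_on_subset)
  then show ?thesis
    unfolding shadow_def by (simp add: image_UN)
qed

lemma packing_image:
  assumes "inj_on f V" "F \<subseteq> Pow V" "packing t F"
  shows "packing t (image f ` F)"
  unfolding packing_def
proof (intro ballI impI)
  fix B' C' assume "B' \<in> image f ` F" "C' \<in> image f ` F" "B' \<noteq> C'"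
  then obtain B C where *: "B \<in> F" "C \<in> F" "B \<noteq> C" "B' = f ` B" "C' = f ` C"
    by blast
  then have sub: "B \<subseteq> V" "C \<subseteq> V"
    using assms(2) by auto
  have "card (B' \<inter> C') = card (f ` (B \<inter> C))"
    using inj_on_image_Int[OF assms(1) sub] * by simp
  also have "\<dots> = card (B \<inter> C)"
    using assms(1) sub by (intro card_image) (blast intro: inj_on_subset)
  also have "\<dots> < t"
    using * assms(3) by (auto simp: packing_def)
  finally show "card (B' \<inter> C') < t" .
qed

text \<open>Two distinct blocks have a common \<open>t\<close>-subset exactly if they meet in at
  least \<open>t\<close> points.\<close>

lemma packing_iff_card_le_1:
  assumes "finite V" "F \<subseteq> nsets V k"
  shows "packing t F \<longleftrightarrow> (\<forall>S\<in>nsets V t. card {B\<in>F. S \<subseteq> B} \<le> 1)"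
proof
  assume pack: "packing t F"
  have fin: "finite F"
    using assms finite_imp_finite_nsets finite_subset by blast
  have "B = C" if "S \<in> nsets V t" "B \<in> F" "S \<subseteq> B" "C \<in> F" "S \<subseteq> C" for S B C
  proof (rule ccontr)
    assume "B \<noteq> C"
    with pack that have "card (B \<inter> C) < t"
      by (auto simp: packing_def)
    moreover have "finite B"
      using that assms by (auto simp: nsets_def)
    ultimately show False
      using that card_mono[of "B \<inter> C" S] by (auto simp: nsets_def)
  qed
  with fin show "\<forall>S\<in>nsets V t. card {B\<in>F. S \<subseteq> B} \<le> 1"
    by (auto simp: card_le_Suc0_iff_eq)
next
  assume le: "\<forall>S\<in>nsets V t. card {B\<in>F. S \<subseteq> B} \<le> 1"
  have fin: "finite F"
    using assms finite_imp_finite_nsets finite_subset by blast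
  show "packing t F"
    unfolding packing_def
  proof (intro ballI impI, rule ccontr)
    fix B C assume BC: "B \<in> F" "C \<in> F" "B \<noteq> C" "\<not> card (B \<inter> C) < t"
    then obtain S where S: "S \<subseteq> B \<inter> C" "card S = t" "finite S"
      by (meson not_less obtain_subset_with_card_n)
    with BC assms have "S \<in> nsets V t"
      by (auto simp: nsets_def)
    with le have "card {B\<in>F. S \<subseteq> B} \<le> Suc 0"
      by simp
    then have "B = C"
      using fin BC S by (auto simp: card_le_Suc0_iff_eq)
    with BC show False by simp
  qed
qed

text \<open>The count is at most one, so it merely records membership in the shadow; equal counts
  for all \<open>S\<close> then amount to equal shadows.\<close>

lemma card_blocks_containing:
  assumes "finite V" "F \<subseteq> nsets V k" "packing t F" "S \<in> nsets V t"
  shows "card {B\<in>F. S \<subseteq> B} = (if S \<in> shadow t F then 1 else 0)"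
proof -
  have fin: "finite {B\<in>F. S \<subseteq> B}"
    using assms finite_imp_finite_nsets finite_subset by (metis (no_types, lifting) mem_Collect_eq subsetI)
  have "card {B\<in>F. S \<subseteq> B} \<le> 1"
    using assms packing_iff_card_le_1 by blast
  moreover have "S \<in> shadow t F \<longleftrightarrow> {B\<in>F. S \<subseteq> B} \<noteq> {}"
    using assms(4) by (auto simp: shadow_def nsets_def)
  ultimately show ?thesis
    using fin by (auto simp: le_Suc_eq)
qed

lemma mu_way_steiner_trade_iff:
  "mu_way_steiner_trade \<mu> V v k t m T \<longleftrightarrow>
     finite V \<and> card V = v \<and> 0 < t \<and> t < k \<and> k < v \<and>
     (\<forall>i\<in>{1..\<mu>}. T i \<subseteq> nsets V k \<and> card (T i) = m \<and> packing t (T i)) \<and>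
     disjoint_family_on T {1..\<mu>} \<and>
     (\<forall>i\<in>{1..\<mu>}. \<forall>j\<in>{1..\<mu>}. shadow t (T i) = shadow t (T j))"
  (is "?trade \<longleftrightarrow> ?rhs")
proof
  assume L: ?trade
  then have fin: "finite V" and sub: "\<And>i. i \<in> {1..\<mu>} \<Longrightarrow> T i \<subseteq> nsets V k"
    by (auto simp: mu_way_steiner_trade_def mu_way_trade_def)
  have pack: "packing t (T i)" if "i \<in> {1..\<mu>}" for i
    using L that packing_iff_card_le_1[OF fin sub[OF that], of t]
    by (auto simp: mu_way_steiner_trade_def)
  have "shadow t (T i) \<subseteq> shadow t (T j)" if ij: "i \<in> {1..\<mu>}" "j \<in> {1..\<mu>}" for i j
  proof
    fix S assume S: "S \<in> shadow t (T i)"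
    have "T i \<subseteq> Pow V"
      using sub[OF ij(1)] by (auto simp: nsets_def)
    with S have SV: "S \<in> nsets V t"
      using shadow_subset by blast
    with L ij have "card {B\<in>T i. S \<subseteq> B} = card {B\<in>T j. S \<subseteq> B}"
      unfolding mu_way_steiner_trade_def mu_way_trade_def by blast
    moreover have "card {B\<in>T i. S \<subseteq> B} = 1"
      using card_blocks_containing[OF fin sub[OF ij(1)] pack[OF ij(1)] SV] S by simp
    ultimately have "card {B\<in>T j. S \<subseteq> B} \<noteq> 0"
      by simp
    then show "S \<in> shadow t (T j)"
      using card_blocks_containing[OF fin sub[OF ij(2)] pack[OF ij(2)] SV] by presburger
  qed
  with L pack show ?rhs
    unfolding mu_way_steiner_trade_def mu_way_trade_def by blast
next
  assume R: ?rhs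
  then have fin: "finite V" and sub: "\<And>i. i \<in> {1..\<mu>} \<Longrightarrow> T i \<subseteq> nsets V k"
    and pack: "\<And>i. i \<in> {1..\<mu>} \<Longrightarrow> packing t (T i)"
    and sh: "\<forall>i\<in>{1..\<mu>}. \<forall>j\<in>{1..\<mu>}. shadow t (T i) = shadow t (T j)"
    by blast+
  have "card {B\<in>T i. S \<subseteq> B} = card {B\<in>T j. S \<subseteq> B}" "card {B\<in>T i. S \<subseteq> B} \<le> 1"
    if "i \<in> {1..\<mu>}" "j \<in> {1..\<mu>}" "S \<in> nsets V t" for i j S
  proof -
    have "shadow t (T i) = shadow t (T j)"
      using sh that by blast
    then show "card {B\<in>T i. S \<subseteq> B} = card {B\<in>T j. S \<subseteq> B}" "card {B\<in>T i. S \<subseteq> B} \<le> 1"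
      using card_blocks_containing[OF fin sub pack that(3), OF that(1,1)]
        card_blocks_containing[OF fin sub pack that(3), OF that(2,2)] by simp_all
  qed
  with R show ?trade
    unfolding mu_way_steiner_trade_def mu_way_trade_def by blast
qed

section \<open>Disjoint unions and relabelling of trades\<close>

lemma mu_way_steiner_trade_Un:
  assumes T: "mu_way_steiner_trade \<mu> V v k t m T"
    and U: "mu_way_steiner_trade \<mu> W w k t n U"
    and disj: "V \<inter> W = {}"
  shows "mu_way_steiner_trade \<mu> (V \<union> W) (v + w) k t (m + n) (\<lambda>i. T i \<union> U i)"
proof -
  have V: "finite V" "card V = v" "0 < t" "t < k" "k < v" and W: "finite W" "card W = w"
    using T U by (auto simp: mu_way_steiner_trade_def mu_way_trade_def)
  have sub: "T i \<subseteq> nsets V k" "U i \<subseteq> nsets W k"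
    and card: "card (T i) = m" "card (U i) = n"
    and pack: "packing t (T i)" "packing t (U i)" if "i \<in> {1..\<mu>}" for i
    using T U that unfolding mu_way_steiner_trade_iff by blast+
  have fin: "finite (T i)" "finite (U i)" if "i \<in> {1..\<mu>}" for i
    using sub[OF that] V(1) W(1) by (meson finite_imp_finite_nsets finite_subset)+
  have no_common: "B \<inter> C = {}" if "B \<in> T i" "C \<in> U j" "i \<in> {1..\<mu>}" "j \<in> {1..\<mu>}" for i j B C
    using sub(1)[OF that(3)] sub(2)[OF that(4)] that(1,2) disj unfolding nsets_def by blast
  \<comment> \<open>Disjoint point sets give disjoint collections because no block is empty, by
    \<open>0 < t\<close> and \<open>t < k\<close>.\<close>
  have TU: "T i \<inter> U j = {}" if "i \<in> {1..\<mu>}" "j \<in> {1..\<mu>}" for i j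
  proof -
    have "B \<noteq> {}" if "B \<in> T i" for B
      using V sub(1)[OF \<open>i \<in> {1..\<mu>}\<close>] that by (auto simp: nsets_def)
    with no_common[OF _ _ that] show ?thesis
      by blast
  qed
  have "T i \<union> U i \<subseteq> nsets (V \<union> W) k \<and> card (T i \<union> U i) = m + n \<and> packing t (T i \<union> U i)"
    if i: "i \<in> {1..\<mu>}" for i
  proof (intro conjI)
    show "T i \<union> U i \<subseteq> nsets (V \<union> W) k"
      using sub[OF i] by (auto simp: nsets_def)
    show "card (T i \<union> U i) = m + n"
      using card[OF i] fin[OF i] TU[OF i i] by (simp add: card_Un_disjoint)
    have "card (B \<inter> C) < t" "card (C \<inter> B) < t" if "B \<in> T i" "C \<in> U i" for B C
      using no_common[OF that i i] V(3) by (simp_all add: Int_commute)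
    then show "packing t (T i \<union> U i)"
      using pack[OF i] unfolding packing_def by blast
  qed
  moreover have "disjoint_family_on (\<lambda>i. T i \<union> U i) {1..\<mu>}"
    unfolding disjoint_family_on_def
  proof (intro ballI impI)
    fix i j assume ij: "i \<in> {1..\<mu>}" "j \<in> {1..\<mu>}" "i \<noteq> j"
    then have "T i \<inter> T j = {}" "U i \<inter> U j = {}"
      using T U unfolding mu_way_steiner_trade_iff disjoint_family_on_def by blast+
    then show "(T i \<union> U i) \<inter> (T j \<union> U j) = {}"
      using TU[OF ij(1,2)] TU[OF ij(2,1)] by blast
  qed
  moreover have "\<forall>i\<in>{1..\<mu>}. \<forall>j\<in>{1..\<mu>}. shadow t (T i \<union> U i) = shadow t (T j \<union> U j)"
    using T U unfolding shadow_Un mu_way_steiner_trade_iff by blast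
  moreover have "finite (V \<union> W)" "card (V \<union> W) = v + w" "k < v + w"
    using V W disj by (simp_all add: card_Un_disjoint)
  ultimately show ?thesis
    using V(3,4) unfolding mu_way_steiner_trade_iff by blast
qed

lemma mu_way_steiner_trade_image:
  assumes T: "mu_way_steiner_trade \<mu> V v k t m T" and f: "inj_on f V"
  shows "mu_way_steiner_trade \<mu> (f ` V) v k t m (\<lambda>i. image f ` T i)"
proof -
  note T' = T[unfolded mu_way_steiner_trade_iff]
  have sub: "T i \<subseteq> nsets V k" and pow: "T i \<subseteq> Pow V" if "i \<in> {1..\<mu>}" for i
    using T' that by (force simp: nsets_def)+
  have inj: "inj_on (image f) (Pow V)"
    using f by (simp add: inj_on_image_Pow)
  have "image f ` T i \<subseteq> nsets (f ` V) k \<and> card (image f ` T i) = m \<and> packing t (image f ` T i)"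
    if i: "i \<in> {1..\<mu>}" for i
  proof (intro conjI)
    show "image f ` T i \<subseteq> nsets (f ` V) k"
      using sub[OF i] nsets_image[OF f] by auto
    show "card (image f ` T i) = m"
      using T' i card_image[OF inj_on_subset[OF inj pow[OF i]]] by simp
    show "packing t (image f ` T i)"
      using T' i pow f by (intro packing_image) auto
  qed
  moreover have "disjoint_family_on (\<lambda>i. image f ` T i) {1..\<mu>}"
    unfolding disjoint_family_on_def
  proof (intro ballI impI)
    fix i j assume ij: "i \<in> {1..\<mu>}" "j \<in> {1..\<mu>}" "i \<noteq> j"
    then have "T i \<inter> T j = {}"
      using T' by (auto simp: disjoint_family_on_def)
    then show "image f ` T i \<inter> image f ` T j = {}"
      using inj_on_image_Int[OF inj pow pow, OF ij(1,2)] by simp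
  qed
  moreover have "shadow t (image f ` T i) = shadow t (image f ` T j)"
    if "i \<in> {1..\<mu>}" "j \<in> {1..\<mu>}" for i j
    using T' that shadow_image[OF f pow, of _ t] by metis
  moreover have "card (f ` V) = v"
    using T' f by (simp add: card_image)
  ultimately show ?thesis
    using T' unfolding mu_way_steiner_trade_iff by blast
qed

lemma steiner_volumes_add:
  assumes "m \<in> steiner_volumes \<mu> t k" "n \<in> steiner_volumes \<mu> t k"
  shows "m + n \<in> steiner_volumes \<mu> t k"
proof -
  obtain v w and V W :: "nat set" and T U where
    T: "mu_way_steiner_trade \<mu> V v k t m T" and U: "mu_way_steiner_trade \<mu> W w k t n U"
    using assms by (auto simp: steiner_volumes_def)
  have "finite V"
    using T by (simp add: mu_way_steiner_trade_iff)
  \<comment> \<open>Shifting \<open>W\<close> past a bound of \<open>V\<close> makes the point sets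
    disjoint.\<close>
  then obtain N where "V \<subseteq> {..<N}"
    using finite_nat_iff_bounded by blast
  then have "V \<inter> (+) N ` W = {}"
    by auto
  moreover have "mu_way_steiner_trade \<mu> ((+) N ` W) w k t n (\<lambda>i. image ((+) N) ` U i)"
    using U by (rule mu_way_steiner_trade_image) simp
  ultimately show ?thesis
    using assms mu_way_steiner_trade_Un[OF T] by (fastforce simp: steiner_volumes_def)
qed

subsection \<open>Lower bound\<close>

text \<open>Two collections of a Steiner trade for pairs and blocks of size 4, without a ground set.
  The conditions are symmetric, so each lemma also serves with \<open>F\<close> and \<open>G\<close>
  exchanged, through \<open>swap\<close>.\<close>

locale trade_pair =
  fixes F G :: "'a set set"
  assumes card_block: "B \<in> F \<union> G \<Longrightarrow> card B = 4"
    and packing: "packing 2 F" "packing 2 G"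
    and shadow_eq: "shadow 2 F = shadow 2 G"
    and disjoint: "F \<inter> G = {}"
begin

lemma swap: "trade_pair G F"
  using card_block packing shadow_eq disjoint by unfold_locales auto

lemma finite_block: "B \<in> F \<union> G \<Longrightarrow> finite B"
  using card_block card.infinite by fastforce

lemma block_unique:
  assumes "B \<in> F" "C \<in> F" "x \<in> B" "x \<in> C" "y \<in> B" "y \<in> C" "x \<noteq> y"
  shows "B = C"
proof (rule ccontr)
  assume "B \<noteq> C"
  then have "card (B \<inter> C) < 2"
    using packing(1) assms by (auto simp: packing_def)
  moreover have "card {x, y} \<le> card (B \<inter> C)"
    using assms finite_block by (intro card_mono) auto
  ultimately show False
    using assms by simp
qed

text \<open>Equal shadows carry pairs over from \<open>F\<close> to \<open>G\<close>. The case
  \<open>x = y\<close> says that a point on a block of \<open>F\<close> also lies on a block of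
  \<open>G\<close>; there, any second point of \<open>B\<close> completes the pair.\<close>

lemma pair_covered:
  assumes "B \<in> F" "x \<in> B" "y \<in> B"
  obtains C where "C \<in> G" "x \<in> C" "y \<in> C"
proof -
  obtain z where z: "z \<in> B" "z \<noteq> x" "y = x \<or> z = y"
  proof (cases "y = x")
    case True
    have "\<not> B \<subseteq> {x}"
      using card_block[of B] card_mono[of "{x}" B] assms by auto
    with True that show ?thesis by blast
  qed (use assms that in blast)
  then have "{x, z} \<in> shadow 2 F"
    using assms by (auto simp: shadow_def)
  then show ?thesis
    using that z(3) unfolding shadow_eq by (auto simp: shadow_def nsets_def)
qed

text \<open>A block \<open>D\<close> of \<open>G\<close> through \<open>x\<close> has the size of
  \<open>B\<close> but differs from it, so it has a point \<open>z\<close> outside \<open>B\<close>;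
  the block of \<open>F\<close> covering \<open>x\<close> and \<open>z\<close> is not
  \<open>B\<close>.\<close>

lemma another_block:
  assumes "B \<in> F" "x \<in> B"
  obtains C where "C \<in> F" "x \<in> C" "C \<noteq> B"
proof -
  interpret sw: trade_pair G F by (rule swap)
  obtain D where D: "D \<in> G" "x \<in> D"
    using pair_covered[of B x x] assms by blast
  with assms have "\<not> D \<subseteq> B"
    using disjoint card_block[of B] card_block[of D] card_subset_eq[of B D] finite_block[of B] by auto
  then obtain z where "z \<in> D" "z \<notin> B"
    by blast
  with D that show ?thesis
    using sw.pair_covered[of D x z] by blast
qed

text \<open>A block of \<open>G\<close> through \<open>x\<close> stays within
  \<open>B \<union> B'\<close>, since its pairs with \<open>x\<close> are covered by
  \<open>F\<close>. Of its three further points, two come from one of these blocks and one from the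
  other: three from the same block would put a block of \<open>F\<close> into
  \<open>G\<close>.\<close>

lemma exchange:
  assumes deg: "{C\<in>F. x \<in> C} = {B, B'}" and ne: "B \<noteq> B'"
  obtains c c' where "c \<in> B - {x}" "c' \<in> B' - {x}"
    "insert c' (B - {c}) \<in> G" "insert c (B' - {c'}) \<in> G"
proof -
  interpret sw: trade_pair G F by (rule swap)
  have B: "B \<in> F" "x \<in> B" "B' \<in> F" "x \<in> B'"
    using deg by auto
  then have BG: "B \<notin> G" "B' \<notin> G"
    using disjoint by auto
  have fin: "finite B" "finite B'"
    using B finite_block by auto
  have cardB: "card (B - {x}) = 3" "card (B' - {x}) = 3"
    using B fin card_block by auto
  have BB': "B \<inter> B' = {x}"
    using B ne block_unique[of B B' x] by blast
  have sub: "D \<subseteq> B \<union> B'" if D: "D \<in> G" "x \<in> D" for D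
  proof
    fix y assume "y \<in> D"
    then obtain C where "C \<in> F" "x \<in> C" "y \<in> C"
      using sw.pair_covered D by blast
    with deg show "y \<in> B \<union> B'"
      by blast
  qed
  have card_split: "card (D \<inter> (B - {x})) + card (D \<inter> (B' - {x})) = 3"
    if D: "D \<in> G" "x \<in> D" for D
  proof -
    have "D - {x} = (D \<inter> (B - {x})) \<union> (D \<inter> (B' - {x}))"
      using sub[OF D] by blast
    moreover have "card (D - {x}) = 3"
      using D card_block[of D] finite_block[of D] by simp
    ultimately show ?thesis
      using fin BB' by (subst card_Un_disjoint[symmetric]) auto
  qed
  have not_all: "card (D \<inter> (B - {x})) \<noteq> 3" if D: "D \<in> G" "x \<in> D" for D
  proof
    assume "card (D \<inter> (B - {x})) = 3"
    then have "D \<inter> (B - {x}) = B - {x}"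
      using cardB fin by (intro card_subset_eq) auto
    then have "B \<subseteq> D"
      using D by blast
    then have "B = D"
      using D B card_block[of B] card_block[of D] finite_block[of D] by (intro card_subset_eq) auto
    with D BG show False by simp
  qed
  obtain D where D: "D \<in> G" "x \<in> D" "card (D \<inter> (B - {x})) = 2"
  proof -
    obtain a where a: "a \<in> B - {x}"
      using cardB by (metis card.empty ex_in_conv zero_neq_numeral)
    obtain D where D: "D \<in> G" "x \<in> D" "a \<in> D"
      using pair_covered[of B x a] B a by blast
    show ?thesis
    proof (cases "card (D \<inter> (B - {x})) = 2")
      case True
      with D that show ?thesis by blast
    next
      case False
      have "D \<inter> (B - {x}) \<noteq> {}"
        using D a by blast
      then have "card (D \<inter> (B - {x})) \<noteq> 0"
        using fin by simp
      with False not_all[OF D(1,2)] card_split[OF D(1,2)] have two: "card (D \<inter> (B' - {x})) = 2"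
        by linarith
      \<comment> \<open>Here \<open>D\<close> takes two points of \<open>B' - {x}\<close>. A block
        of \<open>G\<close> through \<open>x\<close> and a missed point \<open>a2\<close> of
        \<open>B\<close> meets \<open>D\<close> only in \<open>x\<close>, so it takes at most one
        point of \<open>B' - {x}\<close> and hence two of \<open>B - {x}\<close>.\<close>
      have "\<not> B - {x} \<subseteq> D"
        using not_all[OF D(1,2)] cardB by (metis inf_absorb2)
      then obtain a2 where a2: "a2 \<in> B - {x}" "a2 \<notin> D"
        by blast
      obtain D2 where D2: "D2 \<in> G" "x \<in> D2" "a2 \<in> D2"
        using pair_covered[of B x a2] B a2 by blast
      have "D \<inter> D2 \<subseteq> {x}"
        using sw.block_unique[of D D2 x] D D2 a2 by blast
      then have "D2 \<inter> (B' - {x}) \<subseteq> (B' - {x}) - D \<inter> (B' - {x})"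
        by blast
      then have "card (D2 \<inter> (B' - {x})) \<le> card ((B' - {x}) - D \<inter> (B' - {x}))"
        using fin by (intro card_mono) auto
      also have "\<dots> = 1"
        using fin cardB two by (subst card_Diff_subset) auto
      finally have "card (D2 \<inter> (B - {x})) = 2"
        using card_split[OF D2(1,2)] not_all[OF D2(1,2)] by linarith
      with D2 that show ?thesis by blast
    qed
  qed
  \<comment> \<open>\<open>c'\<close> is the point other than \<open>x\<close> that \<open>D\<close>
    takes from \<open>B'\<close>, and \<open>c\<close> is the one that it leaves out of
    \<open>B\<close>.\<close>
  have "card (D \<inter> (B' - {x})) = 1"
    using card_split[OF D(1,2)] D(3) by simp
  then obtain c' where c': "D \<inter> (B' - {x}) = {c'}"
    using card_1_singletonE by blast
  have "card ((B - {x}) - D \<inter> (B - {x})) = 1"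
    using fin cardB D(3) by (subst card_Diff_subset) auto
  then obtain c where c: "(B - {x}) - D \<inter> (B - {x}) = {c}"
    using card_1_singletonE by blast
  have c_mem: "c \<in> B" "c \<noteq> x" "c \<notin> D" and c_uniq: "\<And>y. y \<in> B \<Longrightarrow> y \<notin> D \<Longrightarrow> y = c"
    using c D(2) by blast+
  have c'_mem: "c' \<in> B'" "c' \<noteq> x" "c' \<in> D"
    and c'_uniq: "\<And>y. y \<in> B' \<Longrightarrow> y \<noteq> x \<Longrightarrow> y \<in> D \<Longrightarrow> y = c'"
    using c' by blast+
  have "D = insert c' (B - {c})"
  proof (intro equalityI subsetI)
    fix y assume y: "y \<in> D"
    then have "y \<in> B \<or> y \<in> B'"
      using sub[OF D(1,2)] by blast
    then show "y \<in> insert c' (B - {c})"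
      using y B c_mem c'_uniq by blast
  next
    fix y assume "y \<in> insert c' (B - {c})"
    then show "y \<in> D"
      using c'_mem c_uniq by blast
  qed
  \<comment> \<open>The second block meets \<open>D\<close> only in \<open>x\<close>, so it contains
    neither \<open>c'\<close> nor any point of \<open>B\<close> besides \<open>x\<close> and
    \<open>c\<close>.\<close>
  moreover obtain D' where D': "D' \<in> G" "x \<in> D'" "c \<in> D'"
    using pair_covered[of B x c] B c by blast
  moreover have "D' = insert c (B' - {c'})"
  proof (rule card_subset_eq)
    have inter: "y = x" if "y \<in> D" "y \<in> D'" for y
      using sw.block_unique[of D D' x y] that D D' c_mem by blast
    show "D' \<subseteq> insert c (B' - {c'})"
    proof
      fix y assume y: "y \<in> D'"
      then have "y \<in> B \<or> y \<in> B'"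
        using sub[OF D'(1,2)] by blast
      then show "y \<in> insert c (B' - {c'})"
        using y B inter[of y] c_uniq[of y] c'_mem by blast
    qed
    have "c' \<in> B'" "c \<notin> B'"
      using c_mem c'_mem BB' by blast+
    then show "card D' = card (insert c (B' - {c'}))"
      using D' B fin card_block[of D'] card_block[of B'] by simp
  qed (use fin in simp)
  ultimately show ?thesis
    using that[of c c'] c_mem c'_mem D by blast
qed

end

section \<open>Counting pairs and blocks\<close>

text \<open>With \<open>A = B - {x}\<close> and \<open>A' = B' - {x}\<close>, the condition
  \<open>(a = c) \<noteq> (b = c')\<close> describes the pairs joined by exchanging \<open>c\<close>
  and \<open>c'\<close>. At most three of the nine pairs are joined by neither of two different
  exchanges.\<close>

lemma card_cross_pairs:
  assumes "card A = 3" "card A' = 3" "c \<in> A" "d \<in> A" "c' \<in> A'" "d' \<in> A'" "(c, c') \<noteq> (d, d')"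
  shows "6 \<le> card {(a, b) \<in> A \<times> A'. (a = c) \<noteq> (b = c') \<or> (a = d) \<noteq> (b = d')}"
    (is "6 \<le> card ?E")
proof -
  have fin: "finite A" "finite A'"
    using assms card.infinite by fastforce+
  define W where "W = A \<times> A' - ?E"
  have W: "a \<in> A" "b \<in> A'" "a = c \<longleftrightarrow> b = c'" "a = d \<longleftrightarrow> b = d'" if "(a, b) \<in> W" for a b
    using that by (auto simp: W_def)
  have third: "\<And>a b. a \<in> X \<Longrightarrow> b \<in> X \<Longrightarrow> a \<notin> {p, q} \<Longrightarrow> b \<notin> {p, q} \<Longrightarrow> a = b"
    if "card X = 3" "p \<in> X" "q \<in> X" "p \<noteq> q" for X :: "'c set" and p q
    using that by (auto simp: card_3_iff)
  \<comment> \<open>If \<open>c' \<noteq> d'\<close>, then \<open>a\<close> determines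
    \<open>b\<close> for a pair in \<open>W\<close>: \<open>b\<close> is \<open>c'\<close>,
    \<open>d'\<close> or the third point of \<open>A'\<close>. Otherwise
    \<open>c \<noteq> d\<close>, and \<open>b\<close> determines \<open>a\<close> likewise.\<close>
  have "card W \<le> 3"
  proof (cases "c' = d'")
    case False
    have "inj_on fst W"
    proof (rule inj_onI, clarsimp)
      fix a b b2 assume "(a, b) \<in> W" "(a, b2) \<in> W"
      then show "b = b2"
        using W[of a b] W[of a b2] third[OF assms(2,5,6) False, of b b2] by blast
    qed
    moreover have "fst ` W \<subseteq> A"
      using W(1) by auto
    ultimately show ?thesis
      using card_inj_on_le fin assms(1) by metis
  next
    case True
    with assms have "c \<noteq> d" by simp
    have "inj_on snd W"
    proof (rule inj_onI, clarsimp)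
      fix a b a2 assume "(a, b) \<in> W" "(a2, b) \<in> W"
      then show "a = a2"
        using W[of a b] W[of a2 b] third[OF assms(1,3,4) \<open>c \<noteq> d\<close>, of a a2] by blast
    qed
    moreover have "snd ` W \<subseteq> A'"
      using W(2) by auto
    ultimately show ?thesis
      using card_inj_on_le fin assms(2) by metis
  qed
  moreover have "card W = card (A \<times> A') - card ?E"
    unfolding W_def using fin by (intro card_Diff_subset) (auto intro: finite_subset[of _ "A \<times> A'"])
  ultimately show ?thesis
    using assms by (simp add: card_cartesian_product)
qed

lemma degree_2_imp_card_ge_8:
  assumes FG: "trade_pair F G" and FH: "trade_pair F H" and GH: "G \<inter> H = {}"
    and fin: "finite F" and deg: "{C\<in>F. x \<in> C} = {B, B'}" and ne: "B \<noteq> B'"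
  shows "8 \<le> card F"
proof -
  interpret FG: trade_pair F G by (rule FG)
  interpret FH: trade_pair F H by (rule FH)
  interpret GF: trade_pair G F by (rule FG.swap)
  interpret HF: trade_pair H F by (rule FH.swap)
  have B: "B \<in> F" "x \<in> B" "B' \<in> F" "x \<in> B'"
    using deg by auto
  have BB': "B \<inter> B' = {x}"
    using B ne FG.block_unique[of B B' x] by blast
  obtain c c' where c: "c \<in> B - {x}" "c' \<in> B' - {x}"
      "insert c' (B - {c}) \<in> G" "insert c (B' - {c'}) \<in> G"
    using FG.exchange[OF deg ne] by blast
  obtain d d' where d: "d \<in> B - {x}" "d' \<in> B' - {x}"
      "insert d' (B - {d}) \<in> H" "insert d (B' - {d'}) \<in> H"
    using FH.exchange[OF deg ne] by blast
  define E where
    "E = {(a, b) \<in> (B - {x}) \<times> (B' - {x}). (a = c) \<noteq> (b = c') \<or> (a = d) \<noteq> (b = d')}"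
  \<comment> \<open>Equal exchanges would produce a common block of \<open>G\<close> and
    \<open>H\<close>.\<close>
  have "(c, c') \<noteq> (d, d')"
    using c d GH by auto
  then have "6 \<le> card E"
    unfolding E_def using B c d FG.card_block FG.finite_block by (intro card_cross_pairs) auto
  have "\<exists>C\<in>F. a \<in> C \<and> b \<in> C" if "(a, b) \<in> E" for a b
  proof -
    from that consider "(a = c) \<noteq> (b = c')" | "(a = d) \<noteq> (b = d')"
      by (auto simp: E_def)
    then show ?thesis
    proof cases
      case 1
      with that c obtain D where "D \<in> G" "a \<in> D" "b \<in> D"
        by (auto simp: E_def)
      then show ?thesis
        using GF.pair_covered[of D a b] by blast
    next
      case 2
      with that d obtain D where "D \<in> H" "a \<in> D" "b \<in> D"
        by (auto simp: E_def)
      then show ?thesis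
        using HF.pair_covered[of D a b] by blast
    qed
  qed
  then have "\<forall>p\<in>E. \<exists>C. C \<in> F \<and> fst p \<in> C \<and> snd p \<in> C"
    by fastforce
  then obtain g where "\<forall>p\<in>E. g p \<in> F \<and> fst p \<in> g p \<and> snd p \<in> g p"
    by (rule bchoice[THEN exE])
  then have g: "g (a, b) \<in> F" "a \<in> g (a, b)" "b \<in> g (a, b)" if "(a, b) \<in> E" for a b
    using that by force+
  have E: "a \<in> B" "b \<in> B'" "a \<notin> B'" "b \<notin> B" if "(a, b) \<in> E" for a b
    using that BB' by (auto simp: E_def)
  have gB: "g (a, b) \<noteq> B" "g (a, b) \<noteq> B'" if "(a, b) \<in> E" for a b
    using g[OF that] E[OF that] by auto
  \<comment> \<open>A block serving two pairs with different first entries would share two points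
    with \<open>B\<close> and so equal it; likewise for second entries and
    \<open>B'\<close>.\<close>
  have "inj_on g E"
  proof (rule inj_onI)
    fix p q assume pq: "p \<in> E" "q \<in> E" "g p = g q"
    obtain a b a2 b2 where [simp]: "p = (a, b)" "q = (a2, b2)"
      by fastforce
    have in_E: "(a, b) \<in> E" "(a2, b2) \<in> E"
      using pq by simp_all
    have "a = a2"
      using FG.block_unique[of "g p" B a a2] g[OF in_E(1)] g[OF in_E(2)] gB[OF in_E(1)]
        E[OF in_E(1)] E[OF in_E(2)] pq(3) B by auto
    moreover have "b = b2"
      using FG.block_unique[of "g p" B' b b2] g[OF in_E(1)] g[OF in_E(2)] gB[OF in_E(1)]
        E[OF in_E(1)] E[OF in_E(2)] pq(3) B by auto
    ultimately show "p = q" by simp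
  qed
  moreover have "g ` E \<subseteq> F - {B, B'}"
  proof (rule image_subsetI)
    fix p assume "p \<in> E"
    then show "g p \<in> F - {B, B'}"
      using g(1)[of "fst p" "snd p"] gB[of "fst p" "snd p"] by simp
  qed
  ultimately have "card E \<le> card (F - {B, B'})"
    using fin by (meson card_inj_on_le finite_Diff)
  also have "\<dots> = card F - 2"
    using B ne by (subst card_Diff_subset) auto
  finally show ?thesis
    using \<open>6 \<le> card E\<close> by simp
qed

lemma card_ge_8:
  assumes FG: "trade_pair F G" and FH: "trade_pair F H" and GH: "G \<inter> H = {}"
    and fin: "finite F" and "F \<noteq> {}"
  shows "8 \<le> card F"
proof -
  interpret trade_pair F G by (rule FG)
  obtain B where B: "B \<in> F"
    using \<open>F \<noteq> {}\<close> by blast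
  show ?thesis
  proof (cases "\<exists>x\<in>B. card {C\<in>F. x \<in> C} \<le> 2")
    case True
    then obtain x where x: "x \<in> B" "card {C\<in>F. x \<in> C} \<le> 2"
      by blast
    then obtain B' where B': "B' \<in> F" "x \<in> B'" "B' \<noteq> B"
      using another_block B by blast
    then have "{B, B'} = {C\<in>F. x \<in> C}"
      using B x fin by (intro card_seteq) auto
    then show ?thesis
      using degree_2_imp_card_ge_8[OF FG FH GH fin] B' by metis
  next
    case False
    \<comment> \<open>Leaving out \<open>B\<close> makes these sets disjoint, as any other block of
      \<open>F\<close> meets \<open>B\<close> in at most one point.\<close>
    define S where "S x = {C\<in>F. x \<in> C} - {B}" for x
    have "8 = (\<Sum>x\<in>B. 2::nat)"
      using B card_block by simp
    also have "\<dots> \<le> (\<Sum>x\<in>B. card (S x))"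
    proof (rule sum_mono)
      fix x assume "x \<in> B"
      with False B fin show "2 \<le> card (S x)"
        by (force simp: S_def)
    qed
    also have "\<dots> = card (\<Union>x\<in>B. S x)"
    proof (rule card_UN_disjoint[symmetric])
      show "\<forall>x\<in>B. \<forall>y\<in>B. x \<noteq> y \<longrightarrow> S x \<inter> S y = {}"
        unfolding S_def using block_unique[OF B] by blast
    qed (use B fin finite_block in \<open>auto simp: S_def\<close>)
    also have "\<dots> \<le> card F"
      using fin by (intro card_mono) (auto simp: S_def)
    finally show ?thesis by simp
  qed
qed

lemma steiner_volumes_3_2_4_ge_8:
  assumes "m \<in> steiner_volumes 3 2 4"
  shows "8 \<le> m"
proof -
  obtain v and V :: "nat set" and T where "0 < m" "mu_way_steiner_trade 3 V v 4 2 m T"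
    using assms by (auto simp: steiner_volumes_def)
  then have V: "finite V"
    and T: "\<And>i. i \<in> {1..3} \<Longrightarrow> T i \<subseteq> nsets V 4" "\<And>i. i \<in> {1..3} \<Longrightarrow> card (T i) = m"
      "\<And>i. i \<in> {1..3} \<Longrightarrow> packing 2 (T i)"
    and disj: "disjoint_family_on T {1..3}"
    and shadow: "\<forall>i\<in>{1..3}. \<forall>j\<in>{1..3}. shadow 2 (T i) = shadow 2 (T j)"
    unfolding mu_way_steiner_trade_iff by blast+
  have disj': "T i \<inter> T j = {}" if "i \<in> {1..3}" "j \<in> {1..3}" "i \<noteq> j" for i j
    using disj that unfolding disjoint_family_on_def by blast
  have pair: "trade_pair (T i) (T j)" if "i \<in> {1..3}" "j \<in> {1..3}" "i \<noteq> j" for i j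
  proof
    show "card B = 4" if "B \<in> T i \<union> T j" for B
      using that T(1)[OF \<open>i \<in> {1..3}\<close>] T(1)[OF \<open>j \<in> {1..3}\<close>] by (auto simp: nsets_def)
    show "shadow 2 (T i) = shadow 2 (T j)"
      using shadow that by blast
  qed (use T(3) disj' that in blast)+
  have "8 \<le> card (T 1)"
  proof (rule card_ge_8)
    show "trade_pair (T 1) (T 2)" "trade_pair (T 1) (T 3)" "T 2 \<inter> T 3 = {}"
      by (simp_all add: pair disj')
    have "card (T 1) > 0"
      using T(2)[of 1] \<open>0 < m\<close> by simp
    then show "finite (T 1)" "T 1 \<noteq> {}"
      by (simp_all add: card_gt_0_iff)
  qed
  then show ?thesis
    using T(2)[of 1] by simp
qed

subsection \<open>Existence\<close>

text \<open>The conditions \<open>three_way_blocks\<close> and \<open>rotation_blocks\<close> are phrased for evaluation by rewriting.\<close>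

definition three_way_blocks :: "nat \<Rightarrow> nat \<Rightarrow> nat set set \<Rightarrow> nat set set \<Rightarrow> nat set set \<Rightarrow> bool" where
  "three_way_blocks m v F G H \<longleftrightarrow>
     0 < m \<and> 4 < v \<and>
     (\<forall>X\<in>set [F, G, H]. card X = m \<and>
        (\<forall>B\<in>X. B \<subseteq> {..<v} \<and> card B = 4 \<and> (\<forall>C\<in>X. B = C \<or> card (B \<inter> C) < 2))) \<and>
     (\<forall>(X, Y)\<in>set [(F, G), (G, H), (H, F)].
        X \<inter> Y = {} \<and> (\<forall>B\<in>X. \<forall>x\<in>B. \<forall>y\<in>B. \<exists>C\<in>Y. x \<in> C \<and> y \<in> C))"

text \<open>Covering is checked only from \<open>F\<close> to \<open>G\<close>, \<open>G\<close> to
  \<open>H\<close> and \<open>H\<close> to \<open>F\<close>; this cycle of inclusions makes all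
  three shadows equal.\<close>

lemma three_way_blocks_volume:
  assumes "three_way_blocks m v F G H"
  shows "m \<in> steiner_volumes 3 2 4"
proof -
  have mv: "0 < m" "4 < v"
    using assms by (auto simp: three_way_blocks_def)
  have blocks: "card X = m" "\<forall>B\<in>X. B \<subseteq> {..<v} \<and> card B = 4 \<and> (\<forall>C\<in>X. B = C \<or> card (B \<inter> C) < 2)"
      if "X \<in> {F, G, H}" for X
    using assms that by (auto simp: three_way_blocks_def)
  have disj: "F \<inter> G = {}" "G \<inter> H = {}" "H \<inter> F = {}"
    using assms by (auto simp: three_way_blocks_def)
  have shadow_mono: "shadow 2 X \<subseteq> shadow 2 Y" if "(X, Y) \<in> {(F, G), (G, H), (H, F)}" for X Y
  proof
    have cover: "\<forall>B\<in>X. \<forall>x\<in>B. \<forall>y\<in>B. \<exists>C\<in>Y. x \<in> C \<and> y \<in> C"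
      using assms that by (auto simp: three_way_blocks_def)
    fix S assume "S \<in> shadow 2 X"
    then obtain B x y where B: "B \<in> X" "x \<in> B" "y \<in> B" "x \<noteq> y" "S = {x, y}"
      by (auto simp: shadow_def nsets_2_eq)
    with cover obtain C where "C \<in> Y" "x \<in> C" "y \<in> C"
      by blast
    with B show "S \<in> shadow 2 Y"
      by (auto simp: shadow_def)
  qed
  have shadow: "shadow 2 G = shadow 2 F" "shadow 2 H = shadow 2 F"
    using shadow_mono[of F G] shadow_mono[of G H] shadow_mono[of H F] by auto
  define T where "T i = (if i = 1 then F else if i = 2 then G else H)" for i :: nat
  have T: "T i \<in> {F, G, H}" for i
    by (simp add: T_def)
  have "T i \<subseteq> nsets {..<v} 4 \<and> card (T i) = m \<and> packing 2 (T i)" for i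
    using blocks[OF T[of i]] finite_subset[OF _ finite_lessThan[of v]]
    unfolding nsets_def packing_def by blast
  moreover have "disjoint_family_on T {1..3}"
    using disj by (auto simp: disjoint_family_on_def T_def)
  moreover have "shadow 2 (T i) = shadow 2 F" for i
    using shadow by (simp add: T_def)
  ultimately have "mu_way_steiner_trade 3 {..<v} v 4 2 m T"
    using mv unfolding mu_way_steiner_trade_iff by simp
  with mv show ?thesis
    by (auto simp: steiner_volumes_def)
qed

text \<open>For \<open>n\<close> divisible by 3, this is a permutation with cycles
  \<open>3 * q\<close>, \<open>3 * q + 1\<close>, \<open>3 * q + 2\<close> below \<open>n\<close>
  and fixed points from \<open>n\<close> on. Its iterates produce \<open>G\<close> and
  \<open>H\<close> from \<open>F\<close>.\<close>

definition rotate_triples :: "nat \<Rightarrow> nat \<Rightarrow> nat" where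
  "rotate_triples n x = (if x < n then 3 * (x div 3) + Suc x mod 3 else x)"

definition rotation_blocks :: "nat \<Rightarrow> nat \<Rightarrow> nat \<Rightarrow> nat set set \<Rightarrow> bool" where
  "rotation_blocks m v n F \<longleftrightarrow>
     (let f = image (image (rotate_triples n)) in three_way_blocks m v F (f F) (f (f F)))"

lemma rotation_volume: "rotation_blocks m v n F \<Longrightarrow> m \<in> steiner_volumes 3 2 4"
  unfolding rotation_blocks_def Let_def by (rule three_way_blocks_volume)

section \<open>Explicit trades of volumes 8 to 15\<close>

text \<open>A transversal design with groups \<open>{0, 5, 6}\<close>, \<open>{1, 3, 7}\<close>,
  \<open>{2, 4, 8}\<close>, \<open>{9, 10, 11}\<close>, less its block \<open>{3, 4, 5, 9}\<close>,
  which the rotation fixes.\<close>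

lemma volume_8: "8 \<in> steiner_volumes 3 2 4"
proof (rule rotation_volume)
  show "rotation_blocks 8 12 9
    {{0, 1, 8, 9}, {0, 2, 3, 10}, {0, 4, 7, 11}, {1, 2, 5, 11}, {1, 4, 6, 10}, {2, 6, 7, 9},
     {3, 6, 8, 11}, {5, 7, 8, 10}}"
    by code_simp
qed

text \<open>A full transversal design with groups \<open>{0, 7, 10}\<close>,
  \<open>{1, 8, 11}\<close>, \<open>{2, 6, 9}\<close>, \<open>{3, 4, 5}\<close>.\<close>

lemma volume_9: "9 \<in> steiner_volumes 3 2 4"
proof (rule rotation_volume)
  show "rotation_blocks 9 12 12
    {{0, 1, 2, 4}, {0, 3, 6, 11}, {0, 5, 8, 9}, {1, 3, 7, 9}, {1, 5, 6, 10}, {2, 3, 8, 10},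
     {2, 5, 7, 11}, {4, 6, 7, 8}, {4, 9, 10, 11}}"
    by code_simp
qed

text \<open>For this volume the search found no trade that is cyclic under \<open>rotate_triples\<close>.\<close>

lemma volume_10: "10 \<in> steiner_volumes 3 2 4"
proof (rule three_way_blocks_volume)
  show "three_way_blocks 10 13
    {{0, 1, 2, 3}, {0, 4, 5, 6}, {1, 4, 8, 9}, {1, 5, 7, 11}, {1, 6, 10, 12}, {2, 4, 7, 10},
     {2, 6, 8, 11}, {3, 4, 11, 12}, {3, 5, 8, 10}, {3, 6, 7, 9}}
    {{0, 1, 2, 4}, {0, 3, 5, 6}, {1, 3, 10, 12}, {1, 5, 8, 11}, {1, 6, 7, 9}, {2, 3, 7, 11},
     {2, 6, 8, 10}, {3, 4, 8, 9}, {4, 5, 7, 10}, {4, 6, 11, 12}}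
    {{0, 1, 3, 5}, {0, 2, 4, 6}, {1, 2, 7, 10}, {1, 4, 11, 12}, {1, 6, 8, 9}, {2, 3, 8, 11},
     {3, 4, 7, 9}, {3, 6, 10, 12}, {4, 5, 8, 10}, {5, 6, 7, 11}}"
    by code_simp
qed

text \<open>A projective plane of order 3 without the lines \<open>{0, 1, 2, 12}\<close> and
  \<open>{3, 4, 5, 12}\<close>, both fixed by the rotation.\<close>

lemma volume_11: "11 \<in> steiner_volumes 3 2 4"
proof (rule rotation_volume)
  show "rotation_blocks 11 13 12
    {{0, 3, 7, 11}, {0, 4, 6, 10}, {0, 5, 8, 9}, {1, 3, 9, 10}, {1, 4, 7, 8}, {1, 5, 6, 11},
     {2, 3, 6, 8}, {2, 4, 9, 11}, {2, 5, 7, 10}, {6, 7, 9, 12}, {8, 10, 11, 12}}"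
    by code_simp
qed

text \<open>A projective plane of order 3 without the line \<open>{0, 1, 2, 12}\<close>, which the
  rotation fixes.\<close>

lemma volume_12: "12 \<in> steiner_volumes 3 2 4"
proof (rule rotation_volume)
  show "rotation_blocks 12 13 12
    {{0, 3, 6, 8}, {0, 4, 5, 7}, {0, 9, 10, 11}, {1, 3, 5, 9}, {1, 4, 6, 11}, {1, 7, 8, 10},
     {2, 3, 7, 11}, {2, 4, 8, 9}, {2, 5, 6, 10}, {3, 4, 10, 12}, {5, 8, 11, 12}, {6, 7, 9, 12}}"
    by code_simp
qed

text \<open>The 13 blocks cover all 78 pairs of points: a projective plane of order 3.\<close>

lemma volume_13: "13 \<in> steiner_volumes 3 2 4"
proof (rule rotation_volume)
  show "rotation_blocks 13 13 12
    {{0, 1, 5, 9}, {0, 2, 3, 11}, {0, 4, 6, 8}, {0, 7, 10, 12}, {1, 2, 6, 10}, {1, 3, 8, 12},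
     {1, 4, 7, 11}, {2, 4, 9, 12}, {2, 5, 7, 8}, {3, 4, 5, 10}, {3, 6, 7, 9}, {5, 6, 11, 12},
     {8, 9, 10, 11}}"
    by code_simp
qed

text \<open>Every point lies on four blocks, so the uncovered pairs form a perfect matching: a group
  divisible design with seven groups of size 2.\<close>

lemma volume_14: "14 \<in> steiner_volumes 3 2 4"
proof (rule rotation_volume)
  show "rotation_blocks 14 14 12
    {{0, 1, 9, 11}, {0, 2, 4, 13}, {0, 3, 10, 12}, {0, 5, 6, 8}, {1, 2, 7, 10}, {1, 3, 6, 13},
     {1, 4, 5, 12}, {2, 3, 5, 9}, {2, 8, 11, 12}, {3, 4, 7, 8}, {4, 6, 10, 11}, {5, 7, 11, 13},
     {6, 7, 9, 12}, {8, 9, 10, 13}}"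
    by code_simp
qed

text \<open>An affine plane of order 4 with one point and its five lines deleted; these lines leave
  the groups \<open>{0, 8, 11}\<close>, \<open>{1, 6, 9}\<close>, \<open>{2, 7, 10}\<close>,
  \<open>{3, 4, 5}\<close>, \<open>{12, 13, 14}\<close>.\<close>

lemma volume_15: "15 \<in> steiner_volumes 3 2 4"
proof (rule rotation_volume)
  show "rotation_blocks 15 15 15
    {{0, 1, 5, 12}, {0, 2, 4, 6}, {0, 3, 7, 14}, {0, 9, 10, 13}, {1, 2, 8, 14}, {1, 3, 10, 11},
     {1, 4, 7, 13}, {2, 3, 9, 12}, {2, 5, 11, 13}, {3, 6, 8, 13}, {4, 8, 10, 12}, {4, 9, 11, 14},
     {5, 6, 10, 14}, {5, 7, 8, 9}, {6, 7, 11, 12}}"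
    by code_simp
qed

theorem theorem3p9: "steiner_volumes 3 2 4 = {1..} - {1, 2, 3, 4, 5, 6, 7}"
proof (intro equalityI subsetI)
  fix m assume "m \<in> steiner_volumes 3 2 4"
  then have "8 \<le> m"
    by (rule steiner_volumes_3_2_4_ge_8)
  then show "m \<in> {1..} - {1, 2, 3, 4, 5, 6, 7}"
    by auto
next
  fix m :: nat assume "m \<in> {1..} - {1, 2, 3, 4, 5, 6, 7}"
  then have "8 \<le> m"
    by (auto simp: eval_nat_numeral not_less_eq_eq le_Suc_eq)
  then show "m \<in> steiner_volumes 3 2 4"
  proof (induction m rule: less_induct)
    case (less m)
    show ?case
    proof (cases "m < 16")
      case True
      with less.prems have "m \<in> {8, 9, 10, 11, 12, 13, 14, 15}"
        by auto
      then show ?thesis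
        using volume_8 volume_9 volume_10 volume_11 volume_12 volume_13 volume_14 volume_15 by auto
    next
      case False
      then have "m - 8 \<in> steiner_volumes 3 2 4"
        by (intro less.IH) auto
      then have "(m - 8) + 8 \<in> steiner_volumes 3 2 4"
        using volume_8 by (rule steiner_volumes_add)
      with False show ?thesis by simp
    qed
  qed
qed

end
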